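(* Let $(\gamma,\nu_1,\nu_2):I\to\mathbb{R}^3\times\Delta$ and $(\tilde\gamma,\tilde\nu_1,\tilde\nu_2):J\to\mathbb{R}^3\times\Delta$ be framed curves with curvatures $(\ell,m,n,\alpha)$ and $(\tilde\ell,\tilde m,\tilde n,\tilde\alpha)$ and frame matrix $T=(t_{ij})$. Suppose there exists a smooth function $\theta:I\times J\to\mathbb{R}$ with $t_{32}\cos\theta+t_{31}\sin\theta=0$ on $I\times J$. Let $\mathbf{x}(u,v)=\gamma(u)+\tilde\gamma(v)$, and let $p_0=(u_0,v_0)\in I\times J$ satisfy $\alpha(u_0)=0$, $\tilde\alpha(v_0)=0$ and $\mu(u_0)\times\tilde\mu(v_0)=0$. Then $p_0$ is never a $D_4^{+}$ singular point nor a $D_4^{-}$ singular point of $\mathbf{x}$.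
   Context: All maps are $C^\infty$. $I,J\subset\mathbb{R}$ are intervals, with parameters $u\in I$, $v\in J$; subscripts $u,v$ denote derivatives. $S^2$ is the unit sphere in $\mathbb{R}^3$ and $\Delta=\{(a,b)\in S^2\times S^2 : a\cdot b=0\}$. A framed curve is a smooth map $(\gamma,\nu_1,\nu_2):I\to\mathbb{R}^3\times\Delta$ with $\gamma_u\cdot\nu_1=\gamma_u\cdot\nu_2=0$ on $I$. Put $\mu=\nu_1\times\nu_2$. Its curvature is $(\ell,m,n,\alpha)$ with $\ell=\nu_{1u}\cdot\nu_2$, $m=\nu_{1u}\cdot\mu$, $n=\nu_{2u}\cdot\mu$, $\alpha=\gamma_u\cdot\mu$. The same notation with tildes is used for a framed curve on $J$ with parameter $v$. The frame matrix of the two framed curves is $T=(t_{ij}):I\times J\to SO(3)$ determined by $$\begin{pmatrix}\tilde\nu_1(v)\\ \tilde\nu_2(v)\\ \tilde\mu(v)\end{pmatrix}=T(u,v)\begin{pmatrix}\nu_1(u)\\ \nu_2(u)\\ \mu(u)\end{pmatrix}.$$ Two map germs $\mathbb{R}^2\to\mathbb{R}^3$ are $\mathcal{A}$-equivalent if they coincide up to diffeomorphism germs of the source and of the target. A point $p$ is a $D_4^{+}$ (respectively, $D_4^{-}$) singular point of $\mathbf{x}$ if the germ of $\mathbf{x}$ at $p$ is $\mathcal{A}$-equivalent at $0$ to $(u,v)\mapsto(uv,u^2+3v^2,u^2v+v^3)$ (respectively, $(u,v)\mapsto(uv,u^2-3v^2,u^2v-v^3)$). *)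

theory Defs
  imports "HOL-Analysis.Analysis"
begin

fun Ck_on :: "nat \<Rightarrow> 'a::euclidean_space set \<Rightarrow> ('a \<Rightarrow> 'b::real_normed_vector) \<Rightarrow> bool" where
  "Ck_on 0 U f \<longleftrightarrow> continuous_on U f"
| "Ck_on (Suc k) U f \<longleftrightarrow>
     (\<forall>x\<in>U. f differentiable (at x)) \<and>
     (\<forall>h. Ck_on k U (\<lambda>x. frechet_derivative f (at x) h))"

(* Ck_on is meant for open sets only.  On an arbitrary set S (for instance an interval that
   contains an end point) a function is smooth if it has local smooth extensions to open sets;
   for open S this says that f is of class C^k on S for every k. *)
definition smooth_on :: "'a::euclidean_space set \<Rightarrow> ('a \<Rightarrow> 'b::real_normed_vector) \<Rightarrow> bool" where
  "smooth_on S f \<longleftrightarrow>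
     (\<forall>x\<in>S. \<exists>U g. open U \<and> x \<in> U \<and> (\<forall>k. Ck_on k U g) \<and> (\<forall>y\<in>S \<inter> U. g y = f y))"

definition Delta :: "((real^3) \<times> (real^3)) set" where
  "Delta = {(a, b) \<in> sphere 0 1 \<times> sphere 0 1. a \<bullet> b = 0}"

(* Derivatives are taken within I, so they are one-sided at an end point of I. *)
definition framed_curve ::
    "real set \<Rightarrow> (real \<Rightarrow> real^3) \<Rightarrow> (real \<Rightarrow> real^3) \<Rightarrow> (real \<Rightarrow> real^3) \<Rightarrow> bool" where
  "framed_curve I \<gamma> \<nu>1 \<nu>2 \<longleftrightarrow>
     smooth_on I (\<lambda>u. (\<gamma> u, \<nu>1 u, \<nu>2 u)) \<and>
     (\<forall>u\<in>I. (\<nu>1 u, \<nu>2 u) \<in> Delta \<and>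
        vector_derivative \<gamma> (at u within I) \<bullet> \<nu>1 u = 0 \<and>
        vector_derivative \<gamma> (at u within I) \<bullet> \<nu>2 u = 0)"

definition frame_mu :: "(real \<Rightarrow> real^3) \<Rightarrow> (real \<Rightarrow> real^3) \<Rightarrow> real \<Rightarrow> real^3" where
  "frame_mu \<nu>1 \<nu>2 u = cross3 (\<nu>1 u) (\<nu>2 u)"

definition framed_curvature ::
    "real set \<Rightarrow> (real \<Rightarrow> real^3) \<Rightarrow> (real \<Rightarrow> real^3) \<Rightarrow> (real \<Rightarrow> real^3) \<Rightarrow>
     real \<Rightarrow> real \<times> real \<times> real \<times> real" where
  "framed_curvature I \<gamma> \<nu>1 \<nu>2 u =
     (vector_derivative \<nu>1 (at u within I) \<bullet> \<nu>2 u,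
      vector_derivative \<nu>1 (at u within I) \<bullet> frame_mu \<nu>1 \<nu>2 u,
      vector_derivative \<nu>2 (at u within I) \<bullet> frame_mu \<nu>1 \<nu>2 u,
      vector_derivative \<gamma> (at u within I) \<bullet> frame_mu \<nu>1 \<nu>2 u)"

definition frame_rows :: "(real \<Rightarrow> real^3) \<Rightarrow> (real \<Rightarrow> real^3) \<Rightarrow> real \<Rightarrow> real^3^3" where
  "frame_rows \<nu>1 \<nu>2 u = vector [\<nu>1 u, \<nu>2 u, frame_mu \<nu>1 \<nu>2 u]"

(* For framed curves the frames are invertible, so the matrix equation determines T on I \<times> J. *)
definition is_frame_matrix ::
    "real set \<Rightarrow> real set \<Rightarrow> (real \<Rightarrow> real^3) \<Rightarrow> (real \<Rightarrow> real^3) \<Rightarrow>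
     (real \<Rightarrow> real^3) \<Rightarrow> (real \<Rightarrow> real^3) \<Rightarrow> (real \<times> real \<Rightarrow> real^3^3) \<Rightarrow> bool" where
  "is_frame_matrix I J \<nu>1 \<nu>2 \<nu>1' \<nu>2' T \<longleftrightarrow>
     (\<forall>u\<in>I. \<forall>v\<in>J. rotation_matrix (T (u, v)) \<and>
        frame_rows \<nu>1' \<nu>2' v = T (u, v) ** frame_rows \<nu>1 \<nu>2 u)"

definition diffeo_germ :: "('a::euclidean_space \<Rightarrow> 'a) \<Rightarrow> 'a \<Rightarrow> bool" where
  "diffeo_germ \<phi> p \<longleftrightarrow>
     (\<exists>U V \<psi>. open U \<and> open V \<and> p \<in> U \<and> homeomorphism U V \<phi> \<psi> \<and>
        smooth_on U \<phi> \<and> smooth_on V \<psi>)"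

definition A_equivalent ::
    "('a::euclidean_space \<Rightarrow> 'b::euclidean_space) \<Rightarrow> 'a \<Rightarrow> ('a \<Rightarrow> 'b) \<Rightarrow> 'a \<Rightarrow> bool" where
  "A_equivalent f p g q \<longleftrightarrow>
     (\<exists>\<phi> \<psi>. diffeo_germ \<phi> p \<and> \<phi> p = q \<and> diffeo_germ \<psi> (f p) \<and> \<psi> (f p) = g q \<and>
        (\<forall>\<^sub>F z in nhds p. \<psi> (f z) = g (\<phi> z)))"

definition D4_plus_normal_form :: "real \<times> real \<Rightarrow> real^3" where
  "D4_plus_normal_form = (\<lambda>(u, v). vector [u * v, u^2 + 3 * v^2, u^2 * v + v^3])"

definition D4_minus_normal_form :: "real \<times> real \<Rightarrow> real^3" where
  "D4_minus_normal_form = (\<lambda>(u, v). vector [u * v, u^2 - 3 * v^2, u^2 * v - v^3])"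

(* x is a total function, but only its values on the domain S are meaningful; it has a germ
   at p (defined on a full neighbourhood of p) only if p is an interior point of S. *)
definition D4_plus_singular_point ::
    "(real \<times> real) set \<Rightarrow> (real \<times> real \<Rightarrow> real^3) \<Rightarrow> real \<times> real \<Rightarrow> bool" where
  "D4_plus_singular_point S x p \<longleftrightarrow>
     p \<in> interior S \<and> A_equivalent x p D4_plus_normal_form (0, 0)"

definition D4_minus_singular_point ::
    "(real \<times> real) set \<Rightarrow> (real \<times> real \<Rightarrow> real^3) \<Rightarrow> real \<times> real \<Rightarrow> bool" where
  "D4_minus_singular_point S x p \<longleftrightarrow>
     p \<in> interior S \<and> A_equivalent x p D4_minus_normal_form (0, 0)"

end

theory Submission
  imports Defs
begin

text \<open>
  At \<open>p\<^sub>0\<close> the differential of \<open>x\<close> vanishes. Since \<open>\<gamma>\<^sub>u = \<alpha> \<mu>\<close> and \<open>\<alpha>(u\<^sub>0) = 0\<close>, the second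
  derivative of \<open>\<gamma>\<close> at \<open>u\<^sub>0\<close> is a multiple of \<open>\<mu>(u\<^sub>0)\<close>; likewise for the other curve, and the mixed
  derivative of \<open>x\<close> is zero. As \<open>\<mu>(u\<^sub>0)\<close> and the second \<open>\<mu>(v\<^sub>0)\<close> are parallel, the quadratic part of
  \<open>x\<close> at \<open>p\<^sub>0\<close> takes values in a line. For map germs of rank zero this property is invariant under
  \<open>\<A>\<close>-equivalence, but the quadratic part \<open>(uv, u\<^sup>2 \<plusminus> 3v\<^sup>2, 0)\<close> of the \<open>D\<^sub>4\<close> normal forms spans
  a plane.
\<close>

section \<open>Smoothness at interior points and limits of difference quotients\<close>

text \<open>Near an interior point a local smooth extension agrees with \<open>f\<close>, so its
  derivatives serve as derivatives of \<open>f\<close>. Two levels of \<open>Ck_on\<close> give the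
  second-order information used for framed curves.\<close>

lemma smooth_on_interiorE:
  fixes f :: "'a::euclidean_space \<Rightarrow> 'b::real_normed_vector"
  assumes "smooth_on S f" "x \<in> interior S"
  obtains U D where "open U" "x \<in> U" "U \<subseteq> S"
    "\<And>y. y \<in> U \<Longrightarrow> (f has_derivative D y) (at y)"
    "\<And>h. (\<lambda>y. D y h) differentiable (at x)"
proof -
  have "x \<in> S" using assms(2) interior_subset by (rule subsetD[rotated])
  with assms(1) obtain V g where
    "open V \<and> x \<in> V \<and> (\<forall>k. Ck_on k V g) \<and> (\<forall>y\<in>S \<inter> V. g y = f y)"
    unfolding smooth_on_def by meson
  then have V: "open V" "x \<in> V" "\<And>k. Ck_on k V g" and eq: "\<And>y. y \<in> S \<inter> V \<Longrightarrow> g y = f y"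
    by simp_all
  let ?U = "V \<inter> interior S"
  have U: "open ?U" using V by auto
  have "Ck_on (Suc (Suc 0)) V g" by (rule V(3))
  then have g: "\<And>y. y \<in> V \<Longrightarrow> g differentiable (at y)"
    and D: "\<And>h. (\<lambda>y. frechet_derivative g (at y) h) differentiable (at x)"
    using V(2) by auto
  show thesis
  proof (rule that[of ?U "\<lambda>y. frechet_derivative g (at y)"])
    fix y assume y: "y \<in> ?U"
    have "(g has_derivative frechet_derivative g (at y)) (at y)"
      using g y frechet_derivative_works by blast
    then show "(f has_derivative frechet_derivative g (at y)) (at y)"
      by (rule has_derivative_transform_within_open[OF _ U y])
         (use eq interior_subset[of S] in auto)
  qed (use U V assms(2) interior_subset[of S] D in auto)
qed

text \<open>A chain rule in which the inner family is known only through its rate \<open>r\<close>.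
  It is used with \<open>r h = h\<close> for the source diffeomorphism and with rate
  \<open>h\<close> squared for the target one.\<close>

lemma tendsto_quotient_has_derivative:
  fixes f :: "'a::real_normed_vector \<Rightarrow> 'b::real_normed_vector" and r :: "real \<Rightarrow> real"
  assumes f: "(f has_derivative B) (at a)"
    and c: "((\<lambda>h. (c h - a) /\<^sub>R r h) \<longlongrightarrow> w) (at 0)"
    and r: "(r \<longlongrightarrow> 0) (at 0)" and r0: "\<forall>\<^sub>F h in at 0. r h \<noteq> 0"
  shows "((\<lambda>h. (f (c h) - f a) /\<^sub>R r h) \<longlongrightarrow> B w) (at 0)"
proof -
  interpret B: bounded_linear B using f by (rule has_derivative_bounded_linear)
  \<comment> \<open>The relative remainder of the linear approximation. Its value at
    \<open>a\<close> is 0, which makes it continuous there, so composing it with \<open>c\<close> is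
    safe even where \<open>c h = a\<close>.\<close>
  define E where "E y = (f y - f a - B (y - a)) /\<^sub>R norm (y - a)" for y
  have "((\<lambda>y. norm (E y)) \<longlongrightarrow> 0) (at a)"
    using f unfolding has_derivative_iff_norm E_def by (simp add: divide_inverse mult.commute)
  then have "(E \<longlongrightarrow> 0) (at a)" by (rule tendsto_norm_zero_cancel)
  moreover have "E a = 0" by (simp add: E_def)
  ultimately have E: "(E \<longlongrightarrow> E a) (nhds a)" by (metis tendsto_at_iff_tendsto_nhds)
  have "((\<lambda>h. a + r h *\<^sub>R ((c h - a) /\<^sub>R r h)) \<longlongrightarrow> a + 0 *\<^sub>R w) (at 0)"
    by (intro tendsto_intros r c)
  moreover have "\<forall>\<^sub>F h in at 0. a + r h *\<^sub>R ((c h - a) /\<^sub>R r h) = c h"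
    using r0 by eventually_elim auto
  ultimately have "(c \<longlongrightarrow> a + 0 *\<^sub>R w) (at 0)" by (rule Lim_transform_eventually)
  then have "(c \<longlongrightarrow> a) (at 0)" by simp
  from filterlim_compose[OF E this] have Ec: "((\<lambda>h. E (c h)) \<longlongrightarrow> 0) (at 0)"
    unfolding \<open>E a = 0\<close> .
  \<comment> \<open>This is the remainder divided by \<open>r h\<close>. The factor
    \<open>sgn (r h)\<close> restores the sign lost in the norm of the quotient, since
    \<open>r h\<close> may be negative.\<close>
  have "((\<lambda>h. (sgn (r h) * norm ((c h - a) /\<^sub>R r h)) *\<^sub>R E (c h)) \<longlongrightarrow> 0) (at 0)"
  proof (rule Lim_null_comparison)
    show "\<forall>\<^sub>F h in at 0. norm ((sgn (r h) * norm ((c h - a) /\<^sub>R r h)) *\<^sub>R E (c h))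
            \<le> norm ((c h - a) /\<^sub>R r h) * norm (E (c h))"
      by (intro always_eventually) (auto simp: abs_mult sgn_if)
    have "((\<lambda>h. norm ((c h - a) /\<^sub>R r h) * norm (E (c h))) \<longlongrightarrow> norm w * norm (0::'b)) (at 0)"
      by (intro tendsto_intros c Ec)
    then show "((\<lambda>h. norm ((c h - a) /\<^sub>R r h) * norm (E (c h))) \<longlongrightarrow> 0) (at 0)" by simp
  qed
  from tendsto_add[OF this B.tendsto[OF c]]
  have "((\<lambda>h. (sgn (r h) * norm ((c h - a) /\<^sub>R r h)) *\<^sub>R E (c h) + B ((c h - a) /\<^sub>R r h))
          \<longlongrightarrow> B w) (at 0)" by simp
  moreover have "\<forall>\<^sub>F h in at 0. (sgn (r h) * norm ((c h - a) /\<^sub>R r h)) *\<^sub>R E (c h)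
      + B ((c h - a) /\<^sub>R r h) = (f (c h) - f a) /\<^sub>R r h"
    using r0
  proof eventually_elim
    case (elim h)
    show ?case
    proof (cases "c h = a")
      case False
      have "sgn (r h) * norm ((c h - a) /\<^sub>R r h) * inverse (norm (c h - a)) = inverse (r h)"
        using elim False by (simp add: sgn_if)
      then have "(sgn (r h) * norm ((c h - a) /\<^sub>R r h)) *\<^sub>R E (c h)
          = (f (c h) - f a - B (c h - a)) /\<^sub>R r h"
        by (simp only: E_def scaleR_scaleR)
      then show ?thesis by (simp only: B.scaleR scaleR_add_right[symmetric]) simp
    qed (simp add: B.zero)
  qed
  ultimately show ?thesis by (rule Lim_transform_eventually)
qed

text \<open>Taylor expansion at a critical point: after subtracting the quadratic term, the
  derivative is o(t - a), and the mean value inequality makes the remainder o of the square of t -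
  a.\<close>

lemma tendsto_second_order_quotient:
  fixes f :: "real \<Rightarrow> 'a::real_normed_vector"
  assumes U: "open U" "a \<in> U"
    and f: "\<And>t. t \<in> U \<Longrightarrow> (f has_vector_derivative d t) (at t)"
    and d: "(d has_vector_derivative c) (at a)" and d0: "d a = 0"
  shows "((\<lambda>t. (f t - f a) /\<^sub>R (t - a)\<^sup>2) \<longlongrightarrow> c /\<^sub>R 2) (at a)"
proof (rule tendstoI)
  fix e :: real assume e: "e > 0"
  have "\<forall>e>0. \<exists>k>0. \<forall>y. norm (y - a) < k \<longrightarrow>
      norm (d y - d a - (y - a) *\<^sub>R c) \<le> e * norm (y - a)"
    using d unfolding has_vector_derivative_def has_derivative_at_alt by blast
  then obtain k where k: "k > 0"
    "\<And>y. norm (y - a) < k \<Longrightarrow> norm (d y - (y - a) *\<^sub>R c) \<le> e/2 * norm (y - a)"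
    using e d0 by (metis half_gt_zero diff_zero)
  from U obtain k' where k': "k' > 0" "ball a k' \<subseteq> U" by (meson openE)
  let ?k = "min k k'"
  define g where "g t = f t - ((t - a)\<^sup>2 / 2) *\<^sub>R c" for t
  have g: "(g has_vector_derivative d t - (t - a) *\<^sub>R c) (at t)" if "t \<in> U" for t
    unfolding g_def
    by (rule derivative_eq_intros f that refl | simp)+
  have bound: "norm (g t - g a) \<le> e/2 * (t - a)\<^sup>2" if t: "dist t a < ?k" for t
  proof -
    \<comment> \<open>On this ball the derivative of \<open>g\<close> is at most
      \<open>e/2 * dist t a\<close>; going from \<open>a\<close> to \<open>t\<close> contributes the
      second factor \<open>dist t a\<close>.\<close>
    let ?S = "cball a (dist t a)"
    have S: "s \<in> U" "norm (d s - (s - a) *\<^sub>R c) \<le> e/2 * dist t a" if "s \<in> ?S" for s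
    proof -
      have "dist s a \<le> dist t a" using that by (simp add: dist_commute)
      with t show "s \<in> U" using k' by (auto simp: dist_commute)
      have "norm (d s - (s - a) *\<^sub>R c) \<le> e/2 * dist s a"
        using k(2)[of s] t \<open>dist s a \<le> dist t a\<close> by (simp add: dist_norm)
      also have "\<dots> \<le> e/2 * dist t a" using \<open>dist s a \<le> dist t a\<close> e by simp
      finally show "norm (d s - (s - a) *\<^sub>R c) \<le> e/2 * dist t a" .
    qed
    have "norm (g t - g a) \<le> (e/2 * dist t a) * norm (t - a)"
    proof (rule differentiable_bound[where S = ?S
          and f' = "\<lambda>s h. h *\<^sub>R (d s - (s - a) *\<^sub>R c)"])
      fix s assume s: "s \<in> ?S"
      show "(g has_derivative (\<lambda>h. h *\<^sub>R (d s - (s - a) *\<^sub>R c))) (at s within ?S)"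
        using g[OF S(1)[OF s]] has_derivative_at_withinI
        unfolding has_vector_derivative_def by blast
      show "onorm (\<lambda>h. h *\<^sub>R (d s - (s - a) *\<^sub>R c)) \<le> e/2 * dist t a"
      proof (rule onorm_le)
        fix h :: real
        show "norm (h *\<^sub>R (d s - (s - a) *\<^sub>R c)) \<le> e/2 * dist t a * norm h"
          using mult_left_mono[OF S(2)[OF s] norm_ge_zero[of h]]
          by (simp only: norm_scaleR real_norm_def mult.commute)
      qed
    qed (auto simp: dist_commute)
    then show ?thesis by (simp add: dist_norm power2_eq_square)
  qed
  show "\<forall>\<^sub>F t in at a. dist ((f t - f a) /\<^sub>R (t - a)\<^sup>2) (c /\<^sub>R 2) < e"
    unfolding eventually_at
  proof (intro exI[of _ ?k] conjI ballI impI)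
    fix t assume t: "t \<noteq> a \<and> dist t a < ?k"
    then have p: "(t - a)\<^sup>2 > 0" by simp
    have "inverse ((t - a)\<^sup>2) * ((t - a)\<^sup>2 / 2) = inverse 2" using p by simp
    moreover have "g t - g a = (f t - f a) - ((t - a)\<^sup>2 / 2) *\<^sub>R c" by (simp add: g_def)
    ultimately have "(f t - f a) /\<^sub>R (t - a)\<^sup>2 - c /\<^sub>R 2 = (g t - g a) /\<^sub>R (t - a)\<^sup>2"
      by (simp only: scaleR_diff_right scaleR_scaleR)
    then have "dist ((f t - f a) /\<^sub>R (t - a)\<^sup>2) (c /\<^sub>R 2) = norm ((g t - g a) /\<^sub>R (t - a)\<^sup>2)"
      by (simp only: dist_norm)
    also have "\<dots> = norm (g t - g a) / (t - a)\<^sup>2" by (simp add: divide_inverse)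
    also have "\<dots> \<le> e/2" using bound[of t] t p by (simp only: pos_divide_le_eq)
    finally show "dist ((f t - f a) /\<^sub>R (t - a)\<^sup>2) (c /\<^sub>R 2) < e" using e by simp
  qed (use k k' in auto)
qed

section \<open>Quadratic part of a framed curve at a singular point\<close>

lemma norm_cross3_orthonormal:
  assumes "(a, b) \<in> Delta"
  shows "norm (cross3 a b) = 1"
  using assms norm_cross[of a b] norm_ge_zero[of "cross3 a b"]
  by (auto simp: Delta_def power2_eq_1_iff simp del: norm_ge_zero)

text \<open>Expanding the triple product of \<open>d\<close>, \<open>a\<close>, \<open>b\<close>
  shows that \<open>d\<close> is parallel to \<open>cross3 a b\<close>; expanding a second one, with
  this unit vector, yields the coefficient.\<close>

lemma orthogonal_Delta_eq:
  assumes ab: "(a, b) \<in> Delta" and "d \<bullet> a = 0" "d \<bullet> b = 0"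
  shows "d = (d \<bullet> cross3 a b) *\<^sub>R cross3 a b"
proof -
  let ?m = "cross3 a b"
  have "cross3 d ?m = 0" using assms by (simp add: Lagrange)
  then have "cross3 ?m (cross3 d ?m) = 0" by simp
  then have "(?m \<bullet> ?m) *\<^sub>R d = (?m \<bullet> d) *\<^sub>R ?m" by (metis Lagrange eq_iff_diff_eq_0)
  moreover have "?m \<bullet> ?m = 1" using norm_cross3_orthonormal[OF ab] by (simp add: norm_eq_1)
  ultimately show ?thesis by (simp add: inner_commute)
qed

text \<open>Differentiating \<gamma>' = \<alpha> \<mu> where \<alpha> vanishes leaves only \<alpha>'
  \<mu>, so \<open>k\<close> is half of \<alpha>'(a). One \<open>k\<close> serves all speeds
  \<open>w\<close>, as needed when the surface is approached along arbitrary lines.\<close>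

lemma framed_curve_second_order:
  assumes fc: "framed_curve I \<gamma> \<nu>1 \<nu>2" and a: "a \<in> interior I"
    and \<alpha>: "vector_derivative \<gamma> (at a within I) \<bullet> frame_mu \<nu>1 \<nu>2 a = 0"
  obtains k where "\<And>w. ((\<lambda>h. (\<gamma> (a + h * w) - \<gamma> a) /\<^sub>R h\<^sup>2) \<longlongrightarrow> (w\<^sup>2 * k) *\<^sub>R frame_mu \<nu>1 \<nu>2 a) (at 0)"
proof -
  let ?\<mu> = "frame_mu \<nu>1 \<nu>2"
  from fc have sm: "smooth_on I (\<lambda>u. (\<gamma> u, \<nu>1 u, \<nu>2 u))" by (simp add: framed_curve_def)
  obtain U D where U: "open U" "a \<in> U" "U \<subseteq> I"
    and D: "\<And>t. t \<in> U \<Longrightarrow> ((\<lambda>u. (\<gamma> u, \<nu>1 u, \<nu>2 u)) has_derivative D t) (at t)"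
    and DD: "\<And>h. (\<lambda>t. D t h) differentiable (at a)"
    by (rule smooth_on_interiorE[OF sm a]) blast
  define d where "d t = fst (D t 1)" for t
  have \<gamma>: "(\<gamma> has_vector_derivative d t) (at t)" if "t \<in> U" for t
  proof -
    have D': "(\<gamma> has_derivative (\<lambda>h. fst (D t h))) (at t)"
      using has_derivative_fst[OF D[OF that]] by simp
    then interpret bounded_linear "\<lambda>h. fst (D t h)" by (rule has_derivative_bounded_linear)
    have "fst (D t h) = h *\<^sub>R d t" for h using scaleR[of h 1] by (simp add: d_def)
    with D' show ?thesis by (simp add: has_vector_derivative_def)
  qed
  \<comment> \<open>At interior points the derivative within \<open>I\<close> is the ordinary
    one.\<close>
  have d_within: "vector_derivative \<gamma> (at t within I) = d t" if "t \<in> U" for t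
  proof -
    have "t \<in> interior I" using that U by (meson interiorI)
    then show ?thesis using vector_derivative_at[OF \<gamma>[OF that]] by (simp add: at_within_interior[of t I])
  qed
  have d_eq: "d t = (d t \<bullet> ?\<mu> t) *\<^sub>R ?\<mu> t" if "t \<in> U" for t
  proof -
    have "t \<in> I" using that U(3) by blast
    then have "(\<nu>1 t, \<nu>2 t) \<in> Delta" "d t \<bullet> \<nu>1 t = 0" "d t \<bullet> \<nu>2 t = 0"
      using fc unfolding framed_curve_def by (simp_all flip: d_within[OF that])
    then show ?thesis unfolding frame_mu_def by (rule orthogonal_Delta_eq)
  qed
  have d0: "d a \<bullet> ?\<mu> a = 0" using \<alpha> d_within U by simp
  obtain D1 where "((\<lambda>t. D t 1) has_derivative D1) (at a)"
    using DD[of 1] unfolding differentiable_def ..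
  from has_derivative_fst[OF this] have diff: "d differentiable (at a)"
    unfolding d_def[abs_def] differentiable_def by blast
  have \<nu>: "(\<nu>1 has_derivative (\<lambda>h. fst (snd (D a h)))) (at a)"
    "(\<nu>2 has_derivative (\<lambda>h. snd (snd (D a h)))) (at a)"
    using has_derivative_snd[OF D[OF U(2)]]
    by (auto dest: has_derivative_fst has_derivative_snd)
  have "?\<mu> differentiable (at a)"
    unfolding frame_mu_def[abs_def] differentiable_def
    using bounded_bilinear.FDERIV[OF bilinear_conv_bounded_bilinear[THEN iffD1, OF bilinear_cross] \<nu>]
    by blast
  then obtain c m' where c: "(d has_vector_derivative c) (at a)"
    and m': "(?\<mu> has_vector_derivative m') (at a)"
    using diff by (meson vector_derivative_works)
  have "((\<lambda>t. d t \<bullet> ?\<mu> t) has_vector_derivative (d a \<bullet> m' + c \<bullet> ?\<mu> a)) (at a)"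
    by (rule bounded_bilinear.has_vector_derivative[OF bounded_bilinear_inner c m'])
  \<comment> \<open>The product rule also produces a multiple of \<open>m'\<close>, whose
    coefficient is \<alpha>(a) = 0.\<close>
  from bounded_bilinear.has_vector_derivative[OF bounded_bilinear_scaleR this m']
  have "((\<lambda>t. (d t \<bullet> ?\<mu> t) *\<^sub>R ?\<mu> t) has_vector_derivative (d a \<bullet> m' + c \<bullet> ?\<mu> a) *\<^sub>R ?\<mu> a) (at a)"
    using d0 by simp
  then have "(d has_vector_derivative (d a \<bullet> m' + c \<bullet> ?\<mu> a) *\<^sub>R ?\<mu> a) (at a)"
    by (rule has_vector_derivative_transform_within_open[OF _ U(1,2)]) (rule d_eq[symmetric])
  moreover have "d a = 0" using d_eq[OF U(2)] d0 by (metis scaleR_zero_left)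
  ultimately have lim: "((\<lambda>t. (\<gamma> t - \<gamma> a) /\<^sub>R (t - a)\<^sup>2) \<longlongrightarrow> ((d a \<bullet> m' + c \<bullet> ?\<mu> a) *\<^sub>R ?\<mu> a) /\<^sub>R 2) (at a)"
    using tendsto_second_order_quotient[OF U(1,2) \<gamma>] by blast
  define k where "k = inverse 2 * (d a \<bullet> m' + c \<bullet> ?\<mu> a)"
  from lim have lim: "((\<lambda>t. (\<gamma> t - \<gamma> a) /\<^sub>R (t - a)\<^sup>2) \<longlongrightarrow> k *\<^sub>R ?\<mu> a) (at a)"
    by (simp only: k_def scaleR_scaleR)
  have "((\<lambda>h. (\<gamma> (a + h * w) - \<gamma> a) /\<^sub>R h\<^sup>2) \<longlongrightarrow> (w\<^sup>2 * k) *\<^sub>R ?\<mu> a) (at 0)" for w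
  \<comment> \<open>The substitution t = a + h w tends to \<open>a\<close> while avoiding it only
    for nonzero \<open>w\<close>; for \<open>w = 0\<close> both sides vanish.\<close>
  proof (cases "w = 0")
    case False
    have "filterlim (\<lambda>h. a + h * w) (at a) (at 0)"
      using False by (auto simp: filterlim_at eventually_at intro!: tendsto_eq_intros exI[of _ 1])
    from tendsto_scaleR[OF tendsto_const filterlim_compose[OF lim this], of "w\<^sup>2"]
    have "((\<lambda>h. w\<^sup>2 *\<^sub>R ((\<gamma> (a + h * w) - \<gamma> a) /\<^sub>R (h * w)\<^sup>2)) \<longlongrightarrow> w\<^sup>2 *\<^sub>R (k *\<^sub>R ?\<mu> a)) (at 0)"
      by simp
    moreover have "w\<^sup>2 * inverse ((h * w)\<^sup>2) = inverse (h\<^sup>2)" for h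
      using False by (simp add: power_mult_distrib)
    ultimately show ?thesis by (simp only: scaleR_scaleR)
  qed simp
  then show thesis by (rule that)
qed

section \<open>Quadratic parts under A-equivalence\<close>

text \<open>Here \<open>C\<close> is the differential of the local inverse. The right inverse is
  what allows a direction in the source to be chosen with prescribed image.\<close>

lemma diffeo_germ_derivatives:
  assumes "diffeo_germ \<phi> p"
  obtains A C where "(\<phi> has_derivative A) (at p)" "\<And>z. A (C z) = z"
proof -
  from assms obtain U V \<eta> where U: "open U" "open V" "p \<in> U" and hom: "homeomorphism U V \<phi> \<eta>"
    and sm: "smooth_on U \<phi>" "smooth_on V \<eta>"
    unfolding diffeo_germ_def by blast
  have V: "\<phi> p \<in> V" and \<eta>: "\<eta> (\<phi> p) = p"
    using hom U by (auto simp: homeomorphism_def)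
  obtain A where A: "(\<phi> has_derivative A) (at p)"
    using smooth_on_interiorE[OF sm(1)] U by (metis interior_open)
  obtain C where C: "(\<eta> has_derivative C) (at (\<phi> p))"
    using smooth_on_interiorE[OF sm(2)] U V by (metis interior_open)
  have "((\<lambda>z. \<phi> (\<eta> z)) has_derivative (\<lambda>z. A (C z))) (at (\<phi> p))"
    using has_derivative_compose[OF C] A by (simp add: \<eta>)
  then have "((\<lambda>z. z) has_derivative (\<lambda>z. A (C z))) (at (\<phi> p))"
    by (rule has_derivative_transform_within_open[OF _ U(2) V])
       (use hom in \<open>auto simp: homeomorphism_def\<close>)
  from has_derivative_unique[OF this has_derivative_ident]
  have "A (C z) = z" for z by metis
  with A show thesis by (rule that)
qed

text \<open>
  The number \<open>\<epsilon>\<close> is the sign distinguishing the two normal forms. Only the differentials of the two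
  diffeomorphisms enter the quadratic part, because both map germs have rank zero.
\<close>

lemma not_A_equivalent_D4:
  fixes x :: "real \<times> real \<Rightarrow> real^3"
  assumes quad: "\<And>w. \<exists>s. ((\<lambda>h. (x (p + h *\<^sub>R w) - x p) /\<^sub>R h\<^sup>2) \<longlongrightarrow> s *\<^sub>R e) (at 0)"
    and g: "g = (\<lambda>(u, v). vector [u * v, u\<^sup>2 + \<epsilon> * (3 * v\<^sup>2), u\<^sup>2 * v + \<epsilon> * v ^ 3])"
  shows "\<not> A_equivalent x p g (0, 0)"
proof
  assume "A_equivalent x p g (0, 0)"
  then obtain \<phi> \<psi> where \<phi>: "diffeo_germ \<phi> p" "\<phi> p = (0, 0)" and \<psi>: "diffeo_germ \<psi> (x p)"
    and g0: "\<psi> (x p) = g (0, 0)" and ev: "\<forall>\<^sub>F z in nhds p. \<psi> (x z) = g (\<phi> z)"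
    unfolding A_equivalent_def by blast
  obtain A C where A: "(\<phi> has_derivative A) (at p)" and AC: "\<And>z. A (C z) = z"
    by (rule diffeo_germ_derivatives[OF \<phi>(1)]) blast
  obtain B where B: "(\<psi> has_derivative B) (at (x p))"
    by (rule diffeo_germ_derivatives[OF \<psi>]) blast
  interpret B: bounded_linear B using B by (rule has_derivative_bounded_linear)
  have gz: "g (0, 0) = 0" by (simp add: g vec_eq_iff forall_3)
  \<comment> \<open>In any direction (a, b), the first two entries of the quadratic part of
    \<open>g\<close> form a multiple of those of the fixed vector \<open>B e\<close>.\<close>
  have key: "\<exists>s. a * b = s * B e $ 1 \<and> a\<^sup>2 + \<epsilon> * (3 * b\<^sup>2) = s * B e $ 2" for a b
  proof -
    \<comment> \<open>With this direction, \<phi> moves to first order along (a, b).\<close>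
    define w where "w = C (a, b)"
    have nz: "\<forall>\<^sub>F h in at (0::real). h \<noteq> 0" by (simp add: eventually_at_filter)
    from quad obtain s where s: "((\<lambda>h. (x (p + h *\<^sub>R w) - x p) /\<^sub>R h\<^sup>2) \<longlongrightarrow> s *\<^sub>R e) (at 0)"
      by blast
    \<comment> \<open>Along the line \<open>x\<close> is displaced only by order h squared, so at
      this order \<psi> acts through its differential \<open>B\<close> alone.\<close>
    have "((\<lambda>h. (\<psi> (x (p + h *\<^sub>R w)) - \<psi> (x p)) /\<^sub>R h\<^sup>2) \<longlongrightarrow> B (s *\<^sub>R e)) (at 0)"
      by (rule tendsto_quotient_has_derivative[OF B s])
         (auto intro!: tendsto_eq_intros simp: eventually_at_filter)
    moreover have "((\<lambda>h. p + h *\<^sub>R w) \<longlongrightarrow> p) (at 0)" by (auto intro!: tendsto_eq_intros)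
    then have "\<forall>\<^sub>F h in at 0. \<psi> (x (p + h *\<^sub>R w)) = g (\<phi> (p + h *\<^sub>R w))"
      by (rule filterlim_iff[THEN iffD1, rule_format, OF _ ev])
    then have "\<forall>\<^sub>F h in at 0. (\<psi> (x (p + h *\<^sub>R w)) - \<psi> (x p)) /\<^sub>R h\<^sup>2 = g (\<phi> (p + h *\<^sub>R w)) /\<^sub>R h\<^sup>2"
      by eventually_elim (simp add: g0 gz)
    ultimately have lim: "((\<lambda>h. g (\<phi> (p + h *\<^sub>R w)) /\<^sub>R h\<^sup>2) \<longlongrightarrow> s *\<^sub>R B e) (at 0)"
      by (simp add: tendsto_cong B.scaleR)
    have "((\<lambda>h. (p + h *\<^sub>R w - p) /\<^sub>R h) \<longlongrightarrow> w) (at 0)"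
      by (rule tendsto_eventually) (use nz in eventually_elim, auto)
    from tendsto_quotient_has_derivative[OF A this]
    have "((\<lambda>h. \<phi> (p + h *\<^sub>R w) /\<^sub>R h) \<longlongrightarrow> (a, b)) (at 0)"
      using nz \<phi>(2) by (simp add: w_def AC flip: zero_prod_def)
    from tendsto_fst[OF this] tendsto_snd[OF this]
    have f: "((\<lambda>h. fst (\<phi> (p + h *\<^sub>R w)) / h) \<longlongrightarrow> a) (at 0)"
         "((\<lambda>h. snd (\<phi> (p + h *\<^sub>R w)) / h) \<longlongrightarrow> b) (at 0)"
      by (simp_all add: divide_inverse_commute)
    \<comment> \<open>The first entry of \<open>g\<close>, like the second one below, is homogeneous
      of degree 2, so the division by h squared splits into one \<open>h\<close> for each
      factor.\<close>
    have "(\<lambda>h. (g (\<phi> (p + h *\<^sub>R w)) /\<^sub>R h\<^sup>2) $ 1)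
        = (\<lambda>h. (fst (\<phi> (p + h *\<^sub>R w)) / h) * (snd (\<phi> (p + h *\<^sub>R w)) / h))"
      by (auto simp: g case_prod_beta power2_eq_square divide_inverse fun_eq_iff)
    then have "((\<lambda>h. (g (\<phi> (p + h *\<^sub>R w)) /\<^sub>R h\<^sup>2) $ 1) \<longlongrightarrow> a * b) (at 0)"
      by (simp only:) (intro tendsto_intros f)
    moreover have "((\<lambda>h. (g (\<phi> (p + h *\<^sub>R w)) /\<^sub>R h\<^sup>2) $ 1) \<longlongrightarrow> (s *\<^sub>R B e) $ 1) (at 0)"
      by (intro tendsto_intros lim)
    ultimately have 1: "a * b = s * B e $ 1"
      using tendsto_unique[OF at_neq_bot] by fastforce
    have "(\<lambda>h. (g (\<phi> (p + h *\<^sub>R w)) /\<^sub>R h\<^sup>2) $ 2)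
        = (\<lambda>h. (fst (\<phi> (p + h *\<^sub>R w)) / h)\<^sup>2 + \<epsilon> * (3 * (snd (\<phi> (p + h *\<^sub>R w)) / h)\<^sup>2))"
      by (auto simp: g case_prod_beta power2_eq_square divide_inverse fun_eq_iff algebra_simps)
    then have "((\<lambda>h. (g (\<phi> (p + h *\<^sub>R w)) /\<^sub>R h\<^sup>2) $ 2) \<longlongrightarrow> a\<^sup>2 + \<epsilon> * (3 * b\<^sup>2)) (at 0)"
      by (simp only:) (intro tendsto_intros f)
    moreover have "((\<lambda>h. (g (\<phi> (p + h *\<^sub>R w)) /\<^sub>R h\<^sup>2) $ 2) \<longlongrightarrow> (s *\<^sub>R B e) $ 2) (at 0)"
      by (intro tendsto_intros lim)
    ultimately have 2: "a\<^sup>2 + \<epsilon> * (3 * b\<^sup>2) = s * B e $ 2"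
      using tendsto_unique[OF at_neq_bot] by fastforce
    from 1 2 show ?thesis by blast
  qed
  \<comment> \<open>Direction (1, 0) has quadratic part (0, 1), which forces a nonzero
    \<open>s\<close> and hence a vanishing first entry of \<open>B e\<close>. Direction (1, 1) then
    gives 1 = 0.\<close>
  from key[of 1 0] have "B e $ 1 = 0" by auto
  with key[of 1 1] show False by simp
qed

theorem theorem4p11:
  fixes I J :: "real set"
    and \<gamma> \<nu>1 \<nu>2 \<gamma>' \<nu>1' \<nu>2' :: "real \<Rightarrow> real^3"
    and l m n \<alpha> l' m' n' \<alpha>' :: "real \<Rightarrow> real"
    and T :: "real \<times> real \<Rightarrow> real^3^3"
    and x :: "real \<times> real \<Rightarrow> real^3"
    and u\<^sub>0 v\<^sub>0 :: real
  assumes "is_interval I" and "interior I \<noteq> {}"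
    and "is_interval J" and "interior J \<noteq> {}"
    and "framed_curve I \<gamma> \<nu>1 \<nu>2"
    and "framed_curve J \<gamma>' \<nu>1' \<nu>2'"
    and "\<forall>u\<in>I. framed_curvature I \<gamma> \<nu>1 \<nu>2 u = (l u, m u, n u, \<alpha> u)"
    and "\<forall>v\<in>J. framed_curvature J \<gamma>' \<nu>1' \<nu>2' v = (l' v, m' v, n' v, \<alpha>' v)"
    and "is_frame_matrix I J \<nu>1 \<nu>2 \<nu>1' \<nu>2' T"
    and "\<exists>\<theta>::real \<times> real \<Rightarrow> real. smooth_on (I \<times> J) \<theta> \<and>
           (\<forall>z\<in>I \<times> J. T z $ 3 $ 2 * cos (\<theta> z) + T z $ 3 $ 1 * sin (\<theta> z) = 0)"
    and "\<forall>u\<in>I. \<forall>v\<in>J. x (u, v) = \<gamma> u + \<gamma>' v"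
    and "u\<^sub>0 \<in> I" and "v\<^sub>0 \<in> J"
    and "\<alpha> u\<^sub>0 = 0" and "\<alpha>' v\<^sub>0 = 0"
    and "cross3 (frame_mu \<nu>1 \<nu>2 u\<^sub>0) (frame_mu \<nu>1' \<nu>2' v\<^sub>0) = 0"
  shows "\<not> D4_plus_singular_point (I \<times> J) x (u\<^sub>0, v\<^sub>0) \<and>
         \<not> D4_minus_singular_point (I \<times> J) x (u\<^sub>0, v\<^sub>0)"
proof -
  let ?\<mu> = "frame_mu \<nu>1 \<nu>2 u\<^sub>0" and ?\<mu>' = "frame_mu \<nu>1' \<nu>2' v\<^sub>0"
  have \<alpha>: "vector_derivative \<gamma> (at u\<^sub>0 within I) \<bullet> ?\<mu> = 0"
    "vector_derivative \<gamma>' (at v\<^sub>0 within J) \<bullet> ?\<mu>' = 0"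
    using assms(7,8,12-15) by (auto simp: framed_curvature_def)
  have "norm ?\<mu> = 1"
    using assms(5,12) norm_cross3_orthonormal by (auto simp: framed_curve_def frame_mu_def)
  then have "?\<mu> \<noteq> 0" by auto
  with assms(16) obtain r where r: "?\<mu>' = r *\<^sub>R ?\<mu>"
    by (metis cross_eq_0 collinear_lemma scaleR_zero_left scaleR_zero_right)
  \<comment> \<open>Both normal forms are treated at once through the sign \<epsilon>.\<close>
  have "\<not> A_equivalent x (u\<^sub>0, v\<^sub>0) (\<lambda>(u, v). vector [u * v, u\<^sup>2 + \<epsilon> * (3 * v\<^sup>2), u\<^sup>2 * v + \<epsilon> * v ^ 3]) (0, 0)"
    if int: "(u\<^sub>0, v\<^sub>0) \<in> interior (I \<times> J)" for \<epsilon>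
  proof (rule not_A_equivalent_D4[OF _ refl])
    fix w :: "real \<times> real"
    have int': "u\<^sub>0 \<in> interior I" "v\<^sub>0 \<in> interior J" using int by (auto simp: interior_Times)
    obtain k where k: "((\<lambda>h. (\<gamma> (u\<^sub>0 + h * fst w) - \<gamma> u\<^sub>0) /\<^sub>R h\<^sup>2) \<longlongrightarrow> ((fst w)\<^sup>2 * k) *\<^sub>R ?\<mu>) (at 0)"
      by (rule framed_curve_second_order[OF assms(5) int'(1) \<alpha>(1)]) blast
    obtain k' where k': "((\<lambda>h. (\<gamma>' (v\<^sub>0 + h * snd w) - \<gamma>' v\<^sub>0) /\<^sub>R h\<^sup>2) \<longlongrightarrow> ((snd w)\<^sup>2 * k') *\<^sub>R ?\<mu>') (at 0)"
      by (rule framed_curve_second_order[OF assms(6) int'(2) \<alpha>(2)]) blast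
    have "((\<lambda>h. (u\<^sub>0, v\<^sub>0) + h *\<^sub>R w) \<longlongrightarrow> (u\<^sub>0, v\<^sub>0)) (at 0)" by (auto intro!: tendsto_eq_intros)
    \<comment> \<open>The formula for \<open>x\<close> holds only on the product of the intervals,
      so the line must stay there for small \<open>h\<close>. The quotient then splits into one term
      for each curve, with no mixed term.\<close>
    then have "\<forall>\<^sub>F h in at 0. (u\<^sub>0, v\<^sub>0) + h *\<^sub>R w \<in> interior (I \<times> J)"
      using int by (rule topological_tendstoD[OF _ open_interior])
    then have "\<forall>\<^sub>F h in at 0. (\<gamma> (u\<^sub>0 + h * fst w) - \<gamma> u\<^sub>0) /\<^sub>R h\<^sup>2 + (\<gamma>' (v\<^sub>0 + h * snd w) - \<gamma>' v\<^sub>0) /\<^sub>R h\<^sup>2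
        = (x ((u\<^sub>0, v\<^sub>0) + h *\<^sub>R w) - x (u\<^sub>0, v\<^sub>0)) /\<^sub>R h\<^sup>2"
    proof eventually_elim
      case (elim h)
      then have "(u\<^sub>0, v\<^sub>0) + h *\<^sub>R w \<in> I \<times> J" using interior_subset by blast
      then show ?case using assms(11-13) by (cases w) (auto simp: algebra_simps)
    qed
    with tendsto_add[OF k k']
    have "((\<lambda>h. (x ((u\<^sub>0, v\<^sub>0) + h *\<^sub>R w) - x (u\<^sub>0, v\<^sub>0)) /\<^sub>R h\<^sup>2) \<longlongrightarrow>
        ((fst w)\<^sup>2 * k + (snd w)\<^sup>2 * k' * r) *\<^sub>R ?\<mu>) (at 0)"
      by (simp add: tendsto_cong r scaleR_add_left)
    then show "\<exists>s. ((\<lambda>h. (x ((u\<^sub>0, v\<^sub>0) + h *\<^sub>R w) - x (u\<^sub>0, v\<^sub>0)) /\<^sub>R h\<^sup>2) \<longlongrightarrow> s *\<^sub>R ?\<mu>) (at 0)" ..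
  qed
  from this[of 1] this[of "-1"] show ?thesis
    unfolding D4_plus_singular_point_def D4_minus_singular_point_def
      D4_plus_normal_form_def D4_minus_normal_form_def
    by auto
qed

end
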